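(* Let $b\ge2$ be an integer. Then the sequence $(\mathrm{lnzd}_b(n!))_{n\ge1}$ is eventually periodic if and only if $b=2$.
   Context: For integers $b\ge2$ and $n\ge1$, let $v_b(n)=\max\{e\ge0: b^e\mid n\}$ and $U_b(n)=n/b^{v_b(n)}$. The last nonzero digit of $n$ in base $b$, $\mathrm{lnzd}_b(n)$, is the unique integer with $1\le \mathrm{lnzd}_b(n)\le b-1$ and $\mathrm{lnzd}_b(n)\equiv U_b(n)\pmod b$. *)

theory Defs
  imports "HOL-Number_Theory.Number_Theory"
begin

text \<open>For \<open>b \<ge> 2\<close> and \<open>n \<ge> 1\<close>, \<open>v_b(n)\<close> is the library's \<open>multiplicity b n\<close>, which is
  defined as \<open>Max {e. b ^ e dvd n}\<close> for an arbitrary, not necessarily prime, base \<open>b\<close>.\<close>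

definition U :: "nat \<Rightarrow> nat \<Rightarrow> nat" where
  "U b n = n div b ^ multiplicity b n"

definition lnzd :: "nat \<Rightarrow> nat \<Rightarrow> nat" where
  "lnzd b n = (THE d. 1 \<le> d \<and> d \<le> b - 1 \<and> [d = U b n] (mod b))"

text \<open>Sequences are indexed from 1, so the value at 0 is never inspected.\<close>

definition eventually_periodic :: "(nat \<Rightarrow> 'a) \<Rightarrow> bool" where
  "eventually_periodic a \<longleftrightarrow>
     (\<exists>N\<ge>1. \<exists>p\<ge>1. \<forall>n\<ge>N. a (n + p) = a n)"

lemma multiplicity_eq_Max:
  fixes b n :: nat
  assumes "b \<ge> 2" "n \<ge> 1"
  shows "finite {e. b ^ e dvd n}" "multiplicity b n = Max {e. b ^ e dvd n}"
proof -
  show fin: "finite {e. b ^ e dvd n}"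
    using assms by (intro finite_divisor_powers) auto
  then show "multiplicity b n = Max {e. b ^ e dvd n}"
    by (simp add: multiplicity_def)
qed

lemma lnzd_ex1:
  assumes "b \<ge> 2" "n \<ge> 1"
  shows "\<exists>!d. 1 \<le> d \<and> d \<le> b - 1 \<and> [d = U b n] (mod b)"
proof (rule ex1I)
  have "\<not> b dvd U b n"
    unfolding U_def using assms by (intro multiplicity_decompose) auto
  then have "U b n mod b \<noteq> 0"
    by (simp add: dvd_eq_mod_eq_0)
  moreover have "U b n mod b < b"
    using assms by simp
  ultimately show "1 \<le> U b n mod b \<and> U b n mod b \<le> b - 1 \<and> [U b n mod b = U b n] (mod b)"
    by (auto simp: cong_def)
next
  fix d assume "1 \<le> d \<and> d \<le> b - 1 \<and> [d = U b n] (mod b)"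
  moreover from this assms have "d < b"
    by linarith
  ultimately show "d = U b n mod b"
    by (simp add: cong_def)
qed

lemma lnzd_eq_mod:
  assumes "b \<ge> 2" "n \<ge> 1"
  shows "lnzd b n = U b n mod b"
proof -
  have d: "1 \<le> lnzd b n \<and> lnzd b n \<le> b - 1 \<and> [lnzd b n = U b n] (mod b)"
    unfolding lnzd_def by (rule theI'[OF lnzd_ex1[OF assms]])
  moreover from d assms have "lnzd b n < b"
    by linarith
  ultimately show ?thesis
    by (simp add: cong_def)
qed

end

theory Submission
  imports Defs "HOL-Real_Asymp.Real_Asymp"
begin

text \<open>
  Write \<open>a_r = v_r(b)\<close> and let \<open>q\<close> be the prime factor of \<open>b\<close> maximising \<open>a_r (r - 1)\<close>, the
  largest such prime in case of ties. By Legendre's formula \<open>v_r(n!) = (n - s_r(n)) / (r - 1)\<close>,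
  with \<open>s_r\<close> the digit sum in base \<open>r\<close>. Just below a large power \<open>q^K\<close> almost all base-\<open>q\<close> digits
  are \<open>q - 1\<close>, which makes \<open>s_q(n)\<close> larger than \<open>s_r(n)\<close> for every \<open>r < q\<close>. Hence for
  \<open>n = q^K - s\<close> with \<open>s\<close> fixed and \<open>K\<close> large, \<open>v_b(n!)\<close> is the integer part of \<open>v_q(n!) / a_q\<close>,
  and the last nonzero digit of \<open>n!\<close> determines \<open>v_q(n!)\<close> modulo \<open>a_q\<close>.

  If \<open>p\<close> is a period, passing from \<open>(m - 1)!\<close> to \<open>m!\<close> at \<open>m = q^K - p\<close> and at \<open>m = q^K - q p\<close> must
  have the same effect. These two numbers have \<open>q\<close>-adic valuations differing by \<open>1\<close>, so
  \<open>a_q = 1\<close>. Comparing \<open>m = q^K - p\<close> with \<open>m = q^K - 2 p\<close> modulo \<open>q\<close> then forces \<open>q = 2\<close>, and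
  maximality of \<open>a_q (q - 1) = 1\<close> gives \<open>b = 2\<close>.
\<close>

section \<open>Legendre's formula and digit-sum bounds for valuations of factorials\<close>

lemma multiplicity_fact_rec:
  fixes p :: nat
  assumes p: "prime p"
  shows "multiplicity p (fact n) = n div p + multiplicity p (fact (n div p))"
proof (induction n)
  case 0
  show ?case by simp
next
  case (Suc n)
  have mult: "multiplicity p (fact (Suc k)) = multiplicity p (Suc k) + multiplicity p (fact k)" for k
    using p by (simp add: prime_elem_multiplicity_mult_distrib del: mult_Suc)
  show ?case
  proof (cases "p dvd Suc n")
    case True
    then have div: "Suc n div p = Suc (n div p)"
      by (simp add: div_Suc dvd_eq_mod_eq_0)
    have "Suc n = p * Suc (n div p)"
      using True div by (metis dvd_mult_div_cancel)
    then have "multiplicity p (Suc n) = Suc (multiplicity p (Suc (n div p)))"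
      using p by (metis multiplicity_times_same Suc_not_Zero not_prime_0 not_prime_unit)
    with Suc.IH mult show ?thesis
      by (simp only: div)
  next
    case False
    then have "Suc n div p = n div p"
      by (simp add: div_Suc dvd_eq_mod_eq_0)
    moreover have "multiplicity p (Suc n) = 0"
      using False by (rule not_dvd_imp_multiplicity_0)
    ultimately show ?thesis
      using Suc.IH mult by (simp only: add_0)
  qed
qed

text \<open>In base p, n has at most L digits, each at most p - 1, so the digit sum in Legendre's
  formula is at most (p - 1) * L. The induction strips one digit at a time.\<close>

lemma multiplicity_fact_ge:
  fixes p :: nat
  assumes p: "prime p" and "n < p ^ L"
  shows "n \<le> (p - 1) * multiplicity p (fact n) + (p - 1) * L"
  using assms(2)
proof (induction L arbitrary: n)
  case 0
  then show ?case by simp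
next
  case (Suc L)
  obtain k where k: "p = Suc k" "k > 0"
    using prime_gt_1_nat[OF p] by (metis Suc_lessE zero_less_Suc One_nat_def)
  have "n div p < p ^ L"
    using Suc.prems by (simp add: less_mult_imp_div_less mult.commute)
  then have IH: "n div p \<le> k * multiplicity p (fact (n div p)) + k * L"
    using Suc.IH k by simp
  have "n = p * (n div p) + n mod p"
    by simp
  moreover have "n mod p \<le> k"
    using k by (metis mod_less_divisor less_Suc_eq_le zero_less_Suc)
  ultimately have "n \<le> k * (n div p) + n div p + k"
    using k by (metis add_le_mono le_refl mult_Suc add.commute)
  with IH show ?case
    unfolding multiplicity_fact_rec[OF p, of n] using k by (simp add: algebra_simps)
qed

text \<open>All K base-q digits of q^K - 1 equal q - 1, so its digit sum is exactly K * (q -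
  1).\<close>

lemma multiplicity_fact_prime_power_minus_1:
  fixes q :: nat
  assumes q: "prime q"
  shows "(q - 1) * multiplicity q (fact (q ^ K - 1)) + K * (q - 1) + 1 = q ^ K"
proof (induction K)
  case 0
  then show ?case by simp
next
  case (Suc K)
  obtain k where k: "q = Suc k"
    using prime_gt_0_nat[OF q] by (metis Suc_pred)
  obtain t where t: "q ^ K = Suc t"
    using k by (metis Suc_pred zero_less_Suc zero_less_power)
  have "q ^ Suc K - 1 = k + q * t"
    using k t by (simp add: algebra_simps)
  moreover have "(k + q * t) div q = t"
    using k by (subst div_mult_self2) auto
  ultimately show ?case
    using Suc.IH multiplicity_fact_rec[OF q, of "q ^ Suc K - 1"] k t
    by (simp add: algebra_simps)
qed

lemma multiplicity_fact_mono:
  fixes q :: nat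
  assumes "prime q" "m \<le> n"
  shows "multiplicity q (fact m) \<le> multiplicity q (fact n :: nat)"
  using assms by (intro dvd_imp_multiplicity_le fact_dvd) auto

section \<open>Comparing two primes just below a large prime power\<close>

text \<open>The chords of \<open>ln\<close> from \<open>1\<close> have decreasing slope, so the maximal digit sum
  \<open>(q - 1) * log q x\<close> of a number of size \<open>x\<close> is increasing in the base \<open>q\<close>.\<close>

lemma log_less_ratio:
  fixes r q :: real
  assumes "1 < r" "r < q"
  shows "(r - 1) * log r q < q - 1"
proof -
  \<comment> \<open>The tangent of \<open>ln\<close> at r bounds \<open>ln q\<close>, strictly since
    q differs from r. The tangent at 1, evaluated at 1 / r, bounds the slope 1 / r by the chord
    slope ln r / (r - 1).\<close>
  have "ln (q / r) < q / r - 1"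
    using assms ln_eq_minus_one[of "q / r"] ln_le_minus_one[of "q / r"]
    by (force simp: less_le field_simps)
  then have 1: "ln q < ln r + (q - r) / r"
    using assms by (simp add: ln_div field_simps)
  have "ln (1 / r) \<le> 1 / r - 1"
    using assms by (intro ln_le_minus_one) auto
  then have 2: "(r - 1) / r \<le> ln r"
    using assms by (simp add: ln_div field_simps)
  have "(r - 1) * ln q < (r - 1) * (ln r + (q - r) / r)"
    using 1 assms by (intro mult_strict_left_mono) auto
  also have "\<dots> = (r - 1) * ln r + (q - r) * ((r - 1) / r)"
    by (simp add: algebra_simps)
  also have "\<dots> \<le> (r - 1) * ln r + (q - r) * ln r"
    using 2 assms by (intro add_left_mono mult_left_mono) auto
  also have "\<dots> = (q - 1) * ln r"
    by (simp add: algebra_simps)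
  finally show ?thesis
    using assms by (simp add: log_def field_simps)
qed

text \<open>Numbers below q^K have at most L, about K * log_r q, digits in base r. By
  \<open>log_less_ratio\<close> their maximal digit sum falls short of K * (q - 1) by an amount
  linear in K, which absorbs \<open>s\<close>.\<close>

lemma eventually_power_le_power_linear:
  fixes r q s :: nat
  assumes "1 < r" "r < q"
  shows "\<forall>\<^sub>F K in sequentially. \<exists>L. q ^ K \<le> r ^ L \<and> s + (r - 1) * L \<le> K * (q - 1)"
proof -
  define x where "x = log r q"
  have x0: "x \<ge> 0"
    using assms by (simp add: x_def)
  define d where "d = real q - 1 - (real r - 1) * x"
  have d: "d > 0"
    using log_less_ratio[of r q] assms by (simp add: d_def x_def)
  \<comment> \<open>The summand r covers the cost of rounding L up, at most r - 1.\<close>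
  have "\<forall>\<^sub>F K in sequentially. (real s + real r) \<le> d * real K"
    using d by real_asymp
  then show ?thesis
  proof eventually_elim
    case (elim K)
    define L where "L = nat \<lceil>K * x\<rceil>"
    have L: "K * x \<le> L" "L \<le> K * x + 1"
      using x0 by (auto simp: L_def intro: order.trans[OF le_of_int_ceiling])
    have "real q ^ K = (r powr x) powr K"
      using assms by (simp add: x_def powr_realpow)
    also have "\<dots> = r powr (K * x)"
      by (simp add: powr_powr mult.commute)
    also have "\<dots> \<le> r powr L"
      using L assms by (intro powr_mono) auto
    also have "\<dots> = real r ^ L"
      using assms by (simp add: powr_realpow)
    finally have 1: "q ^ K \<le> r ^ L"
      by (metis of_nat_le_iff of_nat_power)
    have "real s + (real r - 1) * L \<le> real s + (real r - 1) * (K * x + 1)"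
      using L assms by (intro add_left_mono mult_left_mono) auto
    also have "\<dots> \<le> real K * (real q - 1)"
      using elim by (simp add: d_def algebra_simps)
    finally have "real (s + (r - 1) * L) \<le> real (K * (q - 1))"
      using assms by (simp add: of_nat_diff)
    then have "s + (r - 1) * L \<le> K * (q - 1)"
      by (simp only: of_nat_le_iff)
    with 1 show ?case by blast
  qed
qed

lemma eventually_linear_le_power:
  fixes c d q :: nat
  assumes "q \<ge> 2"
  shows "\<forall>\<^sub>F K in sequentially. c + d * K \<le> q ^ K"
proof -
  have "\<forall>\<^sub>F K in sequentially. real c + real d * real K \<le> 2 ^ K"
    by real_asymp
  then show ?thesis
  proof eventually_elim
    case (elim K)
    then have "real (c + d * K) \<le> real (2 ^ K)"
      by simp
    then have "c + d * K \<le> 2 ^ K"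
      by (simp only: of_nat_le_iff)
    also have "\<dots> \<le> q ^ K"
      using assms by (intro power_mono) auto
    finally show ?case .
  qed
qed

text \<open>After multiplication by (q - 1) * (r - 1), Legendre's bounds apply to both sides. If the
  weights a * (q - 1) and a' * (r - 1) differ, the terms of order q^K decide; in a tie with r < q
  the larger digit sum at q decides.\<close>

lemma eventually_multiplicity_fact_le:
  fixes q r a a' s :: nat
  assumes q: "prime q" and r: "prime r" and s: "s \<ge> 1"
    and le: "a' * (r - 1) \<le> a * (q - 1)"
    and eq: "a' * (r - 1) = a * (q - 1) \<Longrightarrow> r \<le> q"
  shows "\<forall>\<^sub>F K in sequentially.
    a' * multiplicity q (fact (q ^ K - s)) \<le> a * multiplicity r (fact (q ^ K - s))"
proof -
  have q2: "q \<ge> 2" and r2: "r \<ge> 2"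
    using q r prime_ge_2_nat by auto
  define A B where "A = a * (q - 1)" and "B = a' * (r - 1)"
  have large: "\<forall>\<^sub>F K in sequentially. s \<le> q ^ K"
    using eventually_linear_le_power[OF q2, of s 0] by simp
  consider "r = q" "A = B" | "r < q" "A = B" | "B < A"
    using le eq unfolding A_def B_def by linarith
  \<comment> \<open>The inequality is what links the upper bound at q, scaled by B, to the lower
    bound at r, scaled by A.\<close>
  then have "\<forall>\<^sub>F K in sequentially. \<exists>L. q ^ K \<le> r ^ L \<and>
      q ^ K * B + (s + (r - 1) * L) * A \<le> q ^ K * A + K * (q - 1) * B + B \<or> r = q \<and> A = B"
  proof cases
    case 1
    then show ?thesis by simp
  next
    case 2
    have "\<forall>\<^sub>F K in sequentially. \<exists>L. q ^ K \<le> r ^ L \<and> s + (r - 1) * L \<le> K * (q - 1)"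
      using 2 r2 by (intro eventually_power_le_power_linear) auto
    then show ?thesis
    proof eventually_elim
      case (elim K)
      then obtain L where L: "q ^ K \<le> r ^ L" "s + (r - 1) * L \<le> K * (q - 1)"
        by blast
      from L(2) have "(s + (r - 1) * L) * B \<le> K * (q - 1) * B"
        by (rule mult_right_mono) auto
      with L(1) show ?case
        unfolding 2(2) by (intro exI[of _ L] disjI1 conjI) linarith+
    qed
  next
    case 3
    \<comment> \<open>The gap A - B >= 1 leaves a full q^K to spare, so the crude length L = q * K
      suffices.\<close>
    have "\<forall>\<^sub>F K in sequentially. s * A + ((r - 1) * q * A) * K \<le> q ^ K"
      by (rule eventually_linear_le_power[OF q2])
    then show ?thesis
    proof eventually_elim
      case (elim K)
      have "q \<le> 2 ^ q"
        by (simp add: less_imp_le)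
      also have "\<dots> \<le> r ^ q"
        using r2 by (intro power_mono) auto
      finally have "q ^ K \<le> r ^ (q * K)"
        unfolding power_mult by (intro power_mono) auto
      moreover have "q ^ K * Suc B \<le> q ^ K * A"
        using 3 by (intro mult_left_mono) auto
      then have "q ^ K * B + q ^ K \<le> q ^ K * A"
        by simp
      with elim have "q ^ K * B + (s + (r - 1) * (q * K)) * A \<le> q ^ K * A"
        by (simp add: algebra_simps)
      ultimately show ?case
        by (intro exI[of _ "q * K"]) auto
    qed
  qed
  with large show ?thesis
  proof eventually_elim
    case (elim K)
    define n where "n = q ^ K - s"
    define v w where "v = multiplicity q (fact n :: nat)" and "w = multiplicity r (fact n :: nat)"
    show ?case
    proof (cases "r = q \<and> A = B")
      case True
      then have "a = a'"
        using q2 by (auto simp: A_def B_def)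
      with True show ?thesis by simp
    next
      case False
      then obtain L where L: "q ^ K \<le> r ^ L"
        "q ^ K * B + (s + (r - 1) * L) * A \<le> q ^ K * A + K * (q - 1) * B + B"
        using elim by blast
      have n: "n + s = q ^ K"
        using elim by (simp add: n_def)
      have "n < r ^ L"
        using n s L(1) by linarith
      then have "n \<le> (r - 1) * w + (r - 1) * L"
        unfolding w_def by (rule multiplicity_fact_ge[OF r])
      then have "q ^ K \<le> (r - 1) * w + (s + (r - 1) * L)"
        using n by linarith
      from mult_right_mono[OF this, of A]
      have w: "q ^ K * A \<le> (r - 1) * w * A + (s + (r - 1) * L) * A"
        by (simp add: algebra_simps)
      have "v \<le> multiplicity q (fact (q ^ K - 1) :: nat)"
        unfolding v_def n_def using s by (intro multiplicity_fact_mono[OF q]) auto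
      then have "(q - 1) * v \<le> (q - 1) * multiplicity q (fact (q ^ K - 1) :: nat)"
        by (rule mult_left_mono) simp
      then have "(q - 1) * v + K * (q - 1) + 1 \<le> q ^ K"
        using multiplicity_fact_prime_power_minus_1[OF q, of K] by linarith
      from mult_right_mono[OF this, of B]
      have v: "(q - 1) * v * B + K * (q - 1) * B + B \<le> q ^ K * B"
        by (simp add: algebra_simps)
      have "(q - 1) * v * B \<le> (r - 1) * w * A"
        using v w L(2) by linarith
      then have "((q - 1) * (r - 1)) * (a' * v) \<le> ((q - 1) * (r - 1)) * (a * w)"
        by (simp add: A_def B_def mult_ac)
      moreover have "(q - 1) * (r - 1) > 0"
        using q2 r2 by simp
      ultimately have "a' * v \<le> a * w"
        by (metis mult_le_cancel1)
      then show ?thesis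
        by (simp add: v_def w_def n_def)
    qed
  qed
qed

section \<open>Valuations in a composite base and what the last digit reveals\<close>

text \<open>The hypothesis says that among the prime factors \<open>r\<close> of \<open>b\<close>, the quotient
  \<open>v_r(n) / v_r(b)\<close> is smallest at \<open>r = q\<close>.\<close>

lemma multiplicity_eq_div:
  fixes b q n :: nat
  assumes b: "b \<ge> 2" and q: "q \<in> prime_factors b" and n: "n > 0"
    and min: "\<And>r. r \<in> prime_factors b \<Longrightarrow>
      multiplicity r b * multiplicity q n \<le> multiplicity q b * multiplicity r n"
  shows "multiplicity b n = multiplicity q n div multiplicity q b"
proof (rule multiplicity_eqI)
  let ?a = "multiplicity q b"
  let ?e = "multiplicity q n div ?a"
  have pq: "prime q" and a: "?a > 0"
    using q b by (auto simp: prime_factors_multiplicity)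
  show "b ^ ?e dvd n"
  proof (rule multiplicity_le_imp_dvd)
    fix r :: nat assume r: "prime r"
    show "multiplicity r (b ^ ?e) \<le> multiplicity r n"
    proof (cases "r \<in> prime_factors b")
      case True
      have "?a * (?e * multiplicity r b) \<le> multiplicity r b * multiplicity q n"
        by (metis mult.assoc mult.commute mult_le_mono1 times_div_less_eq_dividend)
      also have "\<dots> \<le> ?a * multiplicity r n"
        by (rule min[OF True])
      finally have "?e * multiplicity r b \<le> multiplicity r n"
        using a by simp
      then show ?thesis
        using r b by (simp add: prime_elem_multiplicity_power_distrib)
    next
      case False
      then show ?thesis
        using r b by (simp add: prime_elem_multiplicity_power_distrib prime_factors_multiplicity)
    qed
  qed (use b in auto)
  show "\<not> b ^ Suc ?e dvd n"
  proof
    assume "b ^ Suc ?e dvd n"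
    then have "multiplicity q (b ^ Suc ?e) \<le> multiplicity q n"
      using n by (intro dvd_imp_multiplicity_le) auto
    then have "Suc ?e * ?a \<le> multiplicity q n"
      using pq b by (simp add: prime_elem_multiplicity_power_distrib del: mult_Suc power_Suc)
    then have "Suc ?e \<le> ?e"
      using a by (metis less_eq_div_iff_mult_less_eq)
    then show False by simp
  qed
qed

lemma U_times_power_multiplicity: "b ^ multiplicity b n * U b n = n"
  unfolding U_def by (simp add: multiplicity_dvd)

text \<open>Each factor b removed takes away v_q(b) factors q; since their number is the integer
  quotient, the remainder survives.\<close>

lemma multiplicity_U:
  fixes b q n :: nat
  assumes b: "b \<ge> 2" and q: "q \<in> prime_factors b" and n: "n > 0"
    and eq: "multiplicity b n = multiplicity q n div multiplicity q b"
  shows "multiplicity q (U b n) = multiplicity q n mod multiplicity q b"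
proof -
  have "prime q"
    using q by auto
  moreover have "U b n \<noteq> 0"
    using U_times_power_multiplicity[of b n] n by (intro notI) simp
  ultimately have "multiplicity q n = multiplicity b n * multiplicity q b + multiplicity q (U b n)"
    using b by (subst (1) U_times_power_multiplicity[of b n, symmetric])
      (simp add: prime_elem_multiplicity_mult_distrib prime_elem_multiplicity_power_distrib)
  then show ?thesis
    using eq by (metis add_left_imp_eq div_mult_mod_eq)
qed

text \<open>Divisibility by q^k with k <= a depends only on the residue modulo q^a, and both
  valuations lie below a.\<close>

lemma multiplicity_eq_of_cong:
  fixes q x y :: nat
  assumes q: "prime q" and cong: "[x = y] (mod q ^ a)"
    and "multiplicity q x < a" "multiplicity q y < a" "x > 0" "y > 0"
  shows "multiplicity q x = multiplicity q y"
proof -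
  have "q ^ k dvd x \<longleftrightarrow> q ^ k dvd y" if "k \<le> a" for k
    using cong_dvd_iff cong_dvd_modulus_nat[OF cong le_imp_power_dvd[OF that]] by blast
  then have *: "k \<le> multiplicity q x \<longleftrightarrow> k \<le> multiplicity q y" if "k \<le> a" for k
    using that assms by (metis power_dvd_iff_le_multiplicity not_prime_unit neq0_conv)
  show ?thesis
    using *[of "multiplicity q x"] *[of "multiplicity q y"] assms by auto
qed

text \<open>For large K the power q^K is more divisible by q than s, so s alone fixes the valuation.
  The cofactor m is congruent modulo q to minus the q-free part of s.\<close>

lemma multiplicity_power_diff:
  fixes q s :: nat
  assumes q: "prime q" and s: "s > 0" and K: "multiplicity q s < K" "s < q ^ K"
  obtains m where "q ^ K - s = q ^ multiplicity q s * m" "\<not> q dvd m"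
    "m + s div q ^ multiplicity q s = q ^ (K - multiplicity q s)"
    "multiplicity q (q ^ K - s) = multiplicity q s"
proof
  define f where "f = multiplicity q s"
  define t where "t = s div q ^ f"
  have q0: "q > 0"
    using q prime_gt_0_nat by blast
  have st: "s = q ^ f * t"
    unfolding t_def f_def by (simp add: multiplicity_dvd)
  have ndvd: "\<not> q dvd t"
    unfolding t_def f_def using q s by (intro multiplicity_decompose) auto
  have pow: "q ^ K = q ^ f * q ^ (K - f)"
    using K by (simp add: f_def flip: power_add)
  have "t < q ^ (K - f)"
    using K(2) q0 unfolding pow by (subst (asm) st) simp
  then show sum: "(q ^ (K - f) - t) + t = q ^ (K - f)"
    by simp
  show eq: "q ^ K - s = q ^ f * (q ^ (K - f) - t)"
    unfolding pow by (subst st) (simp add: diff_mult_distrib2)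
  have "q dvd q ^ (K - f)"
    using K by (simp add: f_def)
  then show nd: "\<not> q dvd q ^ (K - f) - t"
    using ndvd sum by (metis dvd_add_right_iff)
  show "multiplicity q (q ^ K - s) = f"
    unfolding eq using nd q by (intro multiplicity_eqI) (auto simp: q0)
qed

section \<open>Consequences of equal last digits and choice of the dominant prime\<close>

lemma periodic_add_mult:
  fixes a :: "nat \<Rightarrow> 'a" and i :: nat
  assumes "\<And>n. n \<ge> N \<Longrightarrow> a (n + p) = a n" and "n \<ge> N"
  shows "a (n + i * p) = a n"
proof (induction i)
  case (Suc i)
  have "a ((n + i * p) + p) = a (n + i * p)"
    using assms by simp
  with Suc show ?case by (simp add: algebra_simps)
qed simp


lemma cong_U_if_lnzd_eq:
  fixes b x y :: nat
  assumes "b \<ge> 2" "x > 0" "y > 0" "lnzd b x = lnzd b y" "d dvd b"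
  shows "[U b x = U b y] (mod d)"
proof -
  have "[U b x = U b y] (mod b)"
    using assms by (simp add: lnzd_eq_mod unique_euclidean_semiring_class.cong_def)
  then show ?thesis
    using assms(5) by (rule cong_dvd_modulus_nat)
qed

lemma obtain_dominant_prime_factor:
  fixes b :: nat
  assumes b: "b \<ge> 2"
  obtains q where "q \<in> prime_factors b"
    "\<And>r. r \<in> prime_factors b \<Longrightarrow> multiplicity r b * (r - 1) \<le> multiplicity q b * (q - 1)"
    "\<And>r. r \<in> prime_factors b \<Longrightarrow> multiplicity r b * (r - 1) = multiplicity q b * (q - 1) \<Longrightarrow> r \<le> q"
proof -
  define w where "w r = multiplicity r b * (r - 1)" for r
  \<comment> \<open>Prime factors of b are below b + 1, so maximising \<open>g\<close> is
    lexicographic: first \<open>w\<close>, then r.\<close>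
  define g where "g r = w r * (b + 1) + r" for r
  have fin: "finite (prime_factors b)"
    by simp
  moreover have "prime_factors b \<noteq> {}"
    using b by (auto simp: prime_factorization_empty_iff)
  ultimately obtain q where q: "q \<in> prime_factors b" "g q = Max (g ` prime_factors b)"
    using Max_in[of "g ` prime_factors b"] by fastforce
  have max: "g r \<le> g q" if "r \<in> prime_factors b" for r
    using that q by simp
  have qb: "q \<le> b"
    using q b by (auto intro: dvd_imp_le)
  show ?thesis
  proof (rule that[OF q(1)])
    fix r assume r: "r \<in> prime_factors b"
    show "multiplicity r b * (r - 1) \<le> multiplicity q b * (q - 1)"
    proof (rule ccontr)
      assume "\<not> ?thesis"
      then have "Suc (w q) \<le> w r"
        by (simp add: w_def)
      then have "Suc (w q) * (b + 1) \<le> w r * (b + 1)"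
        by (rule mult_right_mono) auto
      with max[OF r] qb show False
        by (simp add: g_def)
    qed
    assume "multiplicity r b * (r - 1) = multiplicity q b * (q - 1)"
    with max[OF r] show "r \<le> q"
      by (simp add: g_def w_def)
  qed
qed

section \<open>A period forces base 2\<close>

lemma eventually_periodic_lnzd_fact_imp_eq_2:
  fixes b :: nat
  assumes b: "b \<ge> 2" and per: "eventually_periodic (\<lambda>n. lnzd b (fact n))"
  shows "b = 2"
proof -
  obtain N p where p: "p \<ge> 1" and "\<And>n. n \<ge> N \<Longrightarrow> lnzd b (fact (n + p)) = lnzd b (fact n)"
    using per unfolding eventually_periodic_def by blast
  then have per: "lnzd b (fact (n + i * p)) = lnzd b (fact n)" if "n \<ge> N" for n i
    using periodic_add_mult[of N "\<lambda>n. lnzd b (fact n)" p n i] that by blast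
  obtain q where q: "q \<in> prime_factors b"
    and dom: "\<And>r. r \<in> prime_factors b \<Longrightarrow> multiplicity r b * (r - 1) \<le> multiplicity q b * (q - 1)"
    and tie: "\<And>r. r \<in> prime_factors b \<Longrightarrow> multiplicity r b * (r - 1) = multiplicity q b * (q - 1) \<Longrightarrow> r \<le> q"
    using obtain_dominant_prime_factor[OF b] by metis
  define a where "a = multiplicity q b"
  define v where "v n = multiplicity q (fact n :: nat)" for n
  define u where "u n = U b (fact n)" for n
  define f where "f = multiplicity q p"
  have pq: "prime q" and a: "a > 0"
    using q b by (auto simp: prime_factors_multiplicity a_def)
  have q2: "q \<ge> 2"
    using pq prime_ge_2_nat by blast
  have qab: "q ^ a dvd b"
    by (simp add: a_def multiplicity_dvd)
  \<comment> \<open>Here q is the prime that limits the power of b dividing n!.\<close>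
  define good where "good n \<longleftrightarrow> (\<forall>r\<in>prime_factors b.
    multiplicity r b * multiplicity q (fact n :: nat) \<le> a * multiplicity r (fact n :: nat))" for n
  have ev: "\<forall>\<^sub>F K in sequentially. good (q ^ K - s)" if "s \<ge> 1" for s
    unfolding good_def a_def
  proof (intro eventually_ball_finite ballI)
    fix r assume r: "r \<in> prime_factors b"
    then have "prime r" by auto
    from eventually_multiplicity_fact_le[OF pq this that dom[OF r] tie[OF r]]
    show "\<forall>\<^sub>F K in sequentially. multiplicity r b * multiplicity q (fact (q ^ K - s) :: nat)
        \<le> multiplicity q b * multiplicity r (fact (q ^ K - s) :: nat)" .
  qed auto
  have good_mult: "multiplicity b (fact n) = v n div a" if "good n" for n
    using that unfolding v_def a_def good_def by (intro multiplicity_eq_div[OF b q]) auto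
  have good_U: "multiplicity q (u n) = v n mod a" if "good n" for n
    using good_mult[OF that] unfolding v_def a_def u_def by (intro multiplicity_U[OF b q]) auto
  have u_pos: "u n > 0" for n
    using U_times_power_multiplicity[of b "fact n"] unfolding u_def
    by (metis fact_nonzero mult_0_right gr0I)
  have good_cong: "v m mod a = v n mod a"
    if "good m" "good n" "lnzd b (fact m) = lnzd b (fact n)" for m n
  proof -
    have "[u m = u n] (mod q ^ a)"
      unfolding u_def using that b qab by (intro cong_U_if_lnzd_eq) auto
    with multiplicity_eq_of_cong[OF pq this] show ?thesis
      using good_U that a u_pos by simp
  qed
  have v_Suc: "v (q ^ K - s) = multiplicity q (q ^ K - s) + v (q ^ K - (s + 1))"
    if "s < q ^ K" for K s
  proof -
    have "q ^ K - s = Suc (q ^ K - (s + 1))"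
      using that by simp
    then show ?thesis
      using pq unfolding v_def
      by (metis fact_Suc of_nat_id prime_elem_multiplicity_mult_distrib Suc_not_Zero
          fact_nonzero prime_imp_prime_elem)
  qed
  have per': "lnzd b (fact (q ^ K - s)) = lnzd b (fact (q ^ K - t))"
    if "t = s + i * p" "N + t \<le> q ^ K" for K s t i
  proof -
    have "q ^ K - s = q ^ K - t + i * p"
      using that by simp
    then show ?thesis
      using per[of "q ^ K - t" i] that by simp
  qed
  define B where "B = N + (2 + q) * p + 2"
  have "\<forall>\<^sub>F K in sequentially. B + 1 * K \<le> q ^ K"
    by (rule eventually_linear_le_power[OF q2])
  then have "\<forall>\<^sub>F K in sequentially. B \<le> q ^ K"
    by eventually_elim simp
  moreover have "\<forall>\<^sub>F K in sequentially. f + 1 < K"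
    by (rule eventually_gt_at_top)
  ultimately have "\<forall>\<^sub>F K in sequentially. B \<le> q ^ K \<and> f + 1 < K \<and> good (q ^ K - p) \<and>
      good (q ^ K - (p + 1)) \<and> good (q ^ K - q * p) \<and> good (q ^ K - (q * p + 1)) \<and>
      good (q ^ K - 2 * p) \<and> good (q ^ K - (2 * p + 1))"
    using p q2 by (intro eventually_conj ev) auto
  then obtain K where K: "B \<le> q ^ K" "f + 1 < K" and good: "good (q ^ K - p)"
      "good (q ^ K - (p + 1))" "good (q ^ K - q * p)" "good (q ^ K - (q * p + 1))"
      "good (q ^ K - 2 * p)" "good (q ^ K - (2 * p + 1))"
    unfolding eventually_sequentially by blast
  have bounds: "p < q ^ K" "q * p < q ^ K" "2 * p < q ^ K" "N + (q * p + 1) \<le> q ^ K"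
    "N + (2 * p + 1) \<le> q ^ K"
    using K(1) by (auto simp: B_def algebra_simps)
  have fqp: "multiplicity q (q * p) = Suc f"
    unfolding f_def using pq p by (intro multiplicity_times_same) auto
  have mp: "multiplicity q (q ^ K - p) = f"
    by (rule multiplicity_power_diff[OF pq, of p K]) (use p K bounds in \<open>simp_all add: f_def\<close>)
  have mqp: "multiplicity q (q ^ K - q * p) = Suc f"
    by (rule multiplicity_power_diff[OF pq, of "q * p" K]) (use p q2 K bounds fqp in simp_all)

  \<comment> \<open>Both offsets shift by q - 1 periods. The valuations before and after the step to
    m! thus agree modulo a, although the steps add f and f + 1.\<close>
  have "q * p = p + (q - 1) * p" "q * p + 1 = p + 1 + (q - 1) * p"
    using q2 by (auto simp: algebra_simps)
  then have "v (q ^ K - p) mod a = v (q ^ K - q * p) mod a"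
    "v (q ^ K - (p + 1)) mod a = v (q ^ K - (q * p + 1)) mod a"
    using bounds good by (auto intro!: good_cong per')
  then have "[f + v (q ^ K - (p + 1)) = Suc f + v (q ^ K - (p + 1))] (mod a)"
    unfolding unique_euclidean_semiring_class.cong_def v_Suc[OF bounds(1)] v_Suc[OF bounds(2)] mp mqp
    by (metis mod_add_right_eq)
  then have "[f = Suc f] (mod a)"
    by (simp only: cong_add_rcancel_nat)
  then have "a dvd Suc f - f"
    by (metis cong_altdef_nat cong_sym le_SucI le_refl)
  then have a1: "a = 1"
    by simp

  have "q = 2"
  proof (rule ccontr)
    assume "q \<noteq> 2"
    then have "\<not> q dvd 2"
      using pq primes_dvd_imp_eq two_is_prime_nat by blast
    then have f2p: "multiplicity q (2 * p) = f"
      using pq p unfolding f_def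
      by (simp add: prime_elem_multiplicity_mult_distrib not_dvd_imp_multiplicity_0)
    define p0 where "p0 = p div q ^ f"
    have p0: "p = q ^ f * p0"
      unfolding p0_def f_def by (simp add: multiplicity_dvd)
    have ndvd: "\<not> q dvd p0"
      unfolding p0_def f_def using pq p by (intro multiplicity_decompose) auto
    obtain c where c: "b = q * c"
      using qab a1 by auto
    obtain m1 where m1: "q ^ K - p = q ^ f * m1" "\<not> q dvd m1" "m1 + p0 = q ^ (K - f)"
      by (rule multiplicity_power_diff[OF pq, of p K])
        (use p K bounds in \<open>simp_all add: f_def p0_def\<close>)
    have div: "2 * p div q ^ f = 2 * p0"
      using q2 by (subst p0) simp
    obtain m2 where m2: "q ^ K - 2 * p = q ^ f * m2" "m2 + 2 * p0 = q ^ (K - f)"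
      "multiplicity q (q ^ K - 2 * p) = f"
      by (rule multiplicity_power_diff[OF pq, of "2 * p" K])
        (use p K bounds f2p div in simp_all)
    have fact_u: "fact n = b ^ v n * u n" if "good n" for n
      using U_times_power_multiplicity[of b "fact n"] good_mult[OF that] a1
      by (simp add: u_def)
    \<comment> \<open>Since a = 1, v_b and v_q of these factorials coincide, so the exponent of b
      grows by f. The new factor supplies q^f, and c^f = (b / q)^f has to come from the
      rest.\<close>
    have step: "m * u (q ^ K - (s + 1)) = c ^ f * u (q ^ K - s)"
      if "s < q ^ K" "good (q ^ K - s)" "good (q ^ K - (s + 1))" "q ^ K - s = q ^ f * m"
        "multiplicity q (q ^ K - s) = f" for s m
    proof -
      have "fact (q ^ K - s) = (q ^ K - s) * (fact (q ^ K - (s + 1)) :: nat)"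
        using that(1) by (metis Suc_diff_Suc Suc_eq_plus1 fact_Suc of_nat_id)
      then have "b ^ v (q ^ K - s) * u (q ^ K - s)
          = q ^ f * m * (b ^ v (q ^ K - (s + 1)) * u (q ^ K - (s + 1)))"
        using that(2,3,4) by (simp add: fact_u)
      moreover have "b ^ v (q ^ K - s) = q ^ f * c ^ f * b ^ v (q ^ K - (s + 1))"
        unfolding v_Suc[OF that(1)] that(5) by (simp add: power_add c power_mult_distrib)
      ultimately have "(q ^ f * b ^ v (q ^ K - (s + 1))) * (c ^ f * u (q ^ K - s))
          = (q ^ f * b ^ v (q ^ K - (s + 1))) * (m * u (q ^ K - (s + 1)))"
        by (simp only: mult_ac)
      moreover have "q ^ f * b ^ v (q ^ K - (s + 1)) \<noteq> 0"
        using q2 b by simp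
      ultimately show ?thesis
        by (metis mult_left_cancel)
    qed
    have qb: "q dvd b"
      using c by simp
    have "2 * p = p + 1 * p" "2 * p + 1 = p + 1 + 1 * p"
      by auto
    then have cong: "[u (q ^ K - p) = u (q ^ K - 2 * p)] (mod q)"
      "[u (q ^ K - (p + 1)) = u (q ^ K - (2 * p + 1))] (mod q)"
      unfolding u_def using bounds by (auto intro!: cong_U_if_lnzd_eq[OF b _ _ _ qb] per')
    \<comment> \<open>By periodicity the \<open>u\<close> values at the two places agree modulo q,
      so the cofactors m1 and m2 act alike.\<close>
    have "[m1 * u (q ^ K - (p + 1)) = c ^ f * u (q ^ K - 2 * p)] (mod q)"
      unfolding step[OF bounds(1) good(1,2) m1(1) mp] by (intro cong_mult cong cong_refl)
    also have "c ^ f * u (q ^ K - 2 * p) = m2 * u (q ^ K - (2 * p + 1))"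
      by (rule step[OF bounds(3) good(5,6) m2(1) m2(3), symmetric])
    also have "[\<dots> = m2 * u (q ^ K - (p + 1))] (mod q)"
      by (intro cong_mult cong_sym[OF cong(2)] cong_refl)
    finally have "[m1 * u (q ^ K - (p + 1)) = m2 * u (q ^ K - (p + 1))] (mod q)" .
    \<comment> \<open>With a = 1 the valuation of \<open>u\<close> is a remainder modulo 1, so
      \<open>u\<close> is a unit modulo q and cancels.\<close>
    moreover have "multiplicity q (u (q ^ K - (p + 1))) = 0"
      using good_U[OF good(2)] a1 by simp
    then have "coprime (u (q ^ K - (p + 1))) q"
      using pq u_pos by (metis coprime_commute multiplicity_eq_zero_iff neq0_conv
          not_prime_unit prime_imp_coprime)
    ultimately have "[m1 = m2] (mod q)"
      using cong_mult_rcancel_nat by blast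
    moreover have "m1 = m2 + p0"
      using m1(3) m2(2) by simp
    ultimately have "q dvd p0"
      by (simp add: cong_add_lcancel_0_nat cong_0_iff)
    with ndvd show False by simp
  qed
  \<comment> \<open>The maximal weight is now 1 * (2 - 1) = 1, which no odd prime can meet.\<close>
  have r2: "r = 2" if "r \<in> prime_factors b" for r
  proof -
    have "prime r" "multiplicity r b > 0"
      using that b by (auto simp: prime_factors_multiplicity)
    moreover have "multiplicity r b * (r - 1) \<le> 1"
      using dom[OF that] \<open>q = 2\<close> a1 by (simp add: a_def)
    then have "r - 1 \<le> 1"
      using calculation(2) by (metis One_nat_def Suc_leI le_trans mult_le_mono1 mult_1)
    ultimately show ?thesis
      using prime_ge_2_nat[of r] by simp
  qed
  have "b dvd 2"
  proof (rule multiplicity_le_imp_dvd)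
    fix r :: nat assume r: "prime r"
    show "multiplicity r b \<le> multiplicity r 2"
    proof (cases "r \<in> prime_factors b")
      case True
      then show ?thesis
        using r2[OF True] a1 \<open>q = 2\<close> by (simp add: a_def)
    next
      case False
      then show ?thesis
        using r b by (simp add: prime_factors_multiplicity)
    qed
  qed (use b in auto)
  then show "b = 2"
    using b by (auto dest: dvd_imp_le)
qed

section \<open>The binary case and the equivalence\<close>

lemma lnzd_2_eq_1:
  assumes "n > 0"
  shows "lnzd 2 n = 1"
proof -
  have "\<not> 2 dvd U 2 n"
    unfolding U_def using assms by (intro multiplicity_decompose) auto
  then show ?thesis
    using assms by (simp add: lnzd_eq_mod odd_iff_mod_2_eq_one)
qed

theorem theorem4p1:
  fixes b :: nat
  assumes "b \<ge> 2"
  shows "eventually_periodic (\<lambda>n. lnzd b (fact n)) \<longleftrightarrow> b = 2"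
proof
  assume "eventually_periodic (\<lambda>n. lnzd b (fact n))"
  with assms show "b = 2"
    by (rule eventually_periodic_lnzd_fact_imp_eq_2)
next
  assume "b = 2"
  then show "eventually_periodic (\<lambda>n. lnzd b (fact n))"
    by (auto simp: eventually_periodic_def lnzd_2_eq_1)
qed

end
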